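(* Let $n\ge 4$ and let $A=A(x)$ be an $n$-by-$n$ partial reciprocal matrix in which every entry is specified except the $(1,n)$ entry $x$ and the $(n,1)$ entry $1/x$; for $x_0>0$ let $A(x_0)$ be the reciprocal matrix obtained by setting $x=x_0$. Let $MT(A)$ be the maximum $3$-cycle product $a_{ij}a_{jk}a_{ki}$ over all triples of distinct indices none of whose pairs is $\{1,n\}$, and for a full reciprocal matrix $B=[b_{ij}]$ let $MT(B)=\max\{b_{ij}b_{jk}b_{ki}: i,j,k\text{ distinct}\}$. Let $M_S(A)=\max_{2\le j\le n-1}a_{1j}a_{jn}$ and $m_S(A)=\min_{2\le j\le n-1}a_{1j}a_{jn}$. Then there exists $x_0>0$ such that $MT(A(x_0))=MT(A)$, and the set of such $x_0$ is exactly the interval $\frac{1}{MT(A)}M_S(A)\le x_0\le MT(A)\,m_S(A)$.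
   Context: A partial reciprocal matrix has diagonal entries $1$, symmetric pattern of specified entries, and specified entries positive with $a_{ji}=1/a_{ij}$ whenever $a_{ij}$ is specified. A reciprocal matrix is an entrywise positive matrix with $b_{ji}=1/b_{ij}$. *)

theory Defs
  imports Complex_Main
begin

text \<open>
  An \<open>n\<close>-by-\<open>n\<close> matrix is a function on pairs of naturals of which only the values at indices in
  \<open>{1..n}\<close> matter. In a partial matrix, \<open>None\<close> marks an unspecified entry.
\<close>

type_synonym partial_matrix = "nat \<Rightarrow> nat \<Rightarrow> real option"

definition partial_reciprocal :: "nat \<Rightarrow> partial_matrix \<Rightarrow> bool" where
  "partial_reciprocal n A \<longleftrightarrow>
     (\<forall>i\<in>{1..n}. A i i = Some 1) \<and>
     (\<forall>i\<in>{1..n}. \<forall>j\<in>{1..n}. \<forall>a. A i j = Some a \<longrightarrow> a > 0 \<and> A j i = Some (1 / a))"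

definition reciprocal :: "nat \<Rightarrow> (nat \<Rightarrow> nat \<Rightarrow> real) \<Rightarrow> bool" where
  "reciprocal n B \<longleftrightarrow> (\<forall>i\<in>{1..n}. \<forall>j\<in>{1..n}. B i j > 0 \<and> B j i = 1 / B i j)"

definition corner_unspecified :: "nat \<Rightarrow> partial_matrix \<Rightarrow> bool" where
  "corner_unspecified n A \<longleftrightarrow>
     (\<forall>i\<in>{1..n}. \<forall>j\<in>{1..n}. A i j = None \<longleftrightarrow> (i = 1 \<and> j = n) \<or> (i = n \<and> j = 1))"

text \<open>The completion \<open>A(x)\<close>.\<close>

definition completion :: "nat \<Rightarrow> partial_matrix \<Rightarrow> real \<Rightarrow> nat \<Rightarrow> nat \<Rightarrow> real" where
  "completion n A x i j =
     (if i = 1 \<and> j = n then x else if i = n \<and> j = 1 then 1 / x else the (A i j))"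

lemma reciprocal_completion:
  assumes "n \<ge> 2" "partial_reciprocal n A" "corner_unspecified n A" "x > 0"
  shows "reciprocal n (completion n A x)"
  unfolding reciprocal_def
proof (intro ballI)
  fix i j assume ij: "i \<in> {1..n}" "j \<in> {1..n}"
  show "completion n A x i j > 0 \<and> completion n A x j i = 1 / completion n A x i j"
  proof (cases "(i = 1 \<and> j = n) \<or> (i = n \<and> j = 1)")
    case True
    moreover have "n \<noteq> 1"
      using assms(1) by linarith
    ultimately show ?thesis
      using assms(4) by (elim disjE conjE) (simp_all add: completion_def)
  next
    case False
    have "A i j = None \<longleftrightarrow> (i = 1 \<and> j = n) \<or> (i = n \<and> j = 1)"
      by (rule assms(3)[unfolded corner_unspecified_def, rule_format, OF ij])
    with False have "A i j \<noteq> None"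
      by metis
    then obtain a where a: "A i j = Some a"
      by blast
    have "a > 0 \<and> A j i = Some (1 / a)"
      by (rule assms(2)[unfolded partial_reciprocal_def, THEN conjunct2, rule_format, OF ij a])
    moreover have "completion n A x i j = the (A i j)" "completion n A x j i = the (A j i)"
      using False unfolding completion_def by metis+
    ultimately show ?thesis
      using a by simp
  qed
qed

text \<open>
  The maximum 3-cycle product of a full matrix, and of a partial matrix whose only unspecified
  off-diagonal pair is \<open>{1, n}\<close>.
\<close>

definition MT :: "nat \<Rightarrow> (nat \<Rightarrow> nat \<Rightarrow> real) \<Rightarrow> real" where
  "MT n B = Max {B i j * B j k * B k i | i j k.
     i \<in> {1..n} \<and> j \<in> {1..n} \<and> k \<in> {1..n} \<and> i \<noteq> j \<and> j \<noteq> k \<and> i \<noteq> k}"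

definition MT_partial :: "nat \<Rightarrow> partial_matrix \<Rightarrow> real" where
  "MT_partial n A = Max {the (A i j) * the (A j k) * the (A k i) | i j k.
     i \<in> {1..n} \<and> j \<in> {1..n} \<and> k \<in> {1..n} \<and> i \<noteq> j \<and> j \<noteq> k \<and> i \<noteq> k \<and>
     {i, j} \<noteq> {1, n} \<and> {j, k} \<noteq> {1, n} \<and> {k, i} \<noteq> {1, n}}"

definition M_S :: "nat \<Rightarrow> partial_matrix \<Rightarrow> real" where
  "M_S n A = Max ((\<lambda>j. the (A 1 j) * the (A j n)) ` {2..n - 1})"

definition m_S :: "nat \<Rightarrow> partial_matrix \<Rightarrow> real" where
  "m_S n A = Min ((\<lambda>j. the (A 1 j) * the (A j n)) ` {2..n - 1})"

end

theory Submission
  imports Defs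
begin

text \<open>
  Put \<open>p\<^sub>j = a\<^sub>1\<^sub>j a\<^sub>j\<^sub>n\<close>. The 3-cycles through the pair \<open>{1, n}\<close> have the products \<open>x / p\<^sub>j\<close> and
  \<open>p\<^sub>j / x\<close>, so \<open>MT(A(x)) = MT(A)\<close> says exactly that each \<open>p\<^sub>j\<close> satisfies
  \<open>p\<^sub>j / MT(A) \<le> x \<le> MT(A) p\<^sub>j\<close>. The interval is nonempty because \<open>p\<^sub>j / p\<^sub>k\<close> is the product
  of the 3-cycles \<open>1 j k\<close> and \<open>j n k\<close>, both specified, whence \<open>p\<^sub>j / p\<^sub>k \<le> MT(A)\<^sup>2\<close>;
  for \<open>j = k\<close> one uses \<open>MT(A) \<ge> 1\<close>, which holds because reversing a 3-cycle inverts its product.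
\<close>

text \<open>Index sets for the 3-cycles. Recasting both maxima as \<open>Max\<close> of an image of
  a finite set of triples turns their comparison into one between a set and its subset.\<close>

definition full_triples :: "nat \<Rightarrow> (nat \<times> nat \<times> nat) set" where
  "full_triples n = {(i, j, k). i \<in> {1..n} \<and> j \<in> {1..n} \<and> k \<in> {1..n} \<and> i \<noteq> j \<and> j \<noteq> k \<and> i \<noteq> k}"

definition specified_triples :: "nat \<Rightarrow> (nat \<times> nat \<times> nat) set" where
  "specified_triples n = {(i, j, k). (i, j, k) \<in> full_triples n \<and>
     {i, j} \<noteq> {1, n} \<and> {j, k} \<noteq> {1, n} \<and> {k, i} \<noteq> {1, n}}"

definition cycle_product :: "(nat \<Rightarrow> nat \<Rightarrow> real) \<Rightarrow> nat \<times> nat \<times> nat \<Rightarrow> real" where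
  "cycle_product B = (\<lambda>(i, j, k). B i j * B j k * B k i)"

lemma finite_full_triples: "finite (full_triples n)"
  by (rule finite_subset[of _ "{1..n} \<times> {1..n} \<times> {1..n}"]) (auto simp: full_triples_def)

lemma specified_triples_subset: "specified_triples n \<subseteq> full_triples n"
  by (auto simp: specified_triples_def)

lemma MT_eq: "MT n B = Max (cycle_product B ` full_triples n)"
  unfolding MT_def
  by (rule arg_cong[of _ _ Max]) (auto simp: cycle_product_def full_triples_def image_def)

lemma MT_partial_eq:
  "MT_partial n A = Max (cycle_product (\<lambda>i j. the (A i j)) ` specified_triples n)"
  unfolding MT_partial_def
  by (rule arg_cong[of _ _ Max])
    (auto simp: cycle_product_def specified_triples_def full_triples_def image_def)

lemma cycle_product_le_MT_partial:
  assumes "(i, j, k) \<in> specified_triples n"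
  shows "the (A i j) * the (A j k) * the (A k i) \<le> MT_partial n A"
proof -
  have "finite (specified_triples n)"
    by (rule finite_subset[OF specified_triples_subset finite_full_triples])
  then have "cycle_product (\<lambda>i j. the (A i j)) (i, j, k) \<le> MT_partial n A"
    unfolding MT_partial_eq using assms by (intro Max_ge) auto
  then show ?thesis
    by (simp add: cycle_product_def)
qed

text \<open>Enlarging the index set can only raise the maximum, so equality means that no added
  index exceeds the old maximum.\<close>

lemma Max_image_eq_Max_subset_iff:
  assumes "finite T" "S \<subseteq> T" "S \<noteq> {}"
  shows "Max (f ` T) = Max (f ` S) \<longleftrightarrow> (\<forall>t\<in>T - S. f t \<le> Max (f ` S))"
proof -
  have finS: "finite S"
    using assms finite_subset by blast
  have "Max (f ` S) \<le> Max (f ` T)"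
    using assms by (intro Max_mono) auto
  then have "Max (f ` T) = Max (f ` S) \<longleftrightarrow> Max (f ` T) \<le> Max (f ` S)"
    by auto
  also have "\<dots> \<longleftrightarrow> (\<forall>t\<in>T. f t \<le> Max (f ` S))"
    using assms by (subst Max_le_iff) auto
  also have "\<dots> \<longleftrightarrow> (\<forall>t\<in>T - S. f t \<le> Max (f ` S))"
    using finS by auto
  finally show ?thesis .
qed

lemma specified_entry:
  assumes "partial_reciprocal n A" "corner_unspecified n A"
    and "i \<in> {1..n}" "j \<in> {1..n}" "\<not> (i = 1 \<and> j = n)" "\<not> (i = n \<and> j = 1)"
  shows "the (A i j) > 0" "the (A j i) = 1 / the (A i j)"
proof -
  obtain a where "A i j = Some a"
    using assms unfolding corner_unspecified_def by fastforce
  then show "the (A i j) > 0" "the (A j i) = 1 / the (A i j)"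
    using assms unfolding partial_reciprocal_def by force+
qed

text \<open>A triple using the pair \<open>{1, n}\<close> has one further vertex \<open>j\<close>,
  which lies strictly between \<open>1\<close> and \<open>n\<close>; the six orderings are the
  rotations of \<open>(1, j, n)\<close> and of its reversal \<open>(n, j, 1)\<close>.\<close>

lemma unspecified_triples:
  assumes "n \<ge> 2"
  shows "full_triples n - specified_triples n =
    (\<Union>j\<in>{2..n - 1}. {(1, j, n), (j, n, 1), (n, 1, j), (n, j, 1), (j, 1, n), (1, n, j)})"
  (is "_ = ?R")
proof (intro equalityI subsetI)
  fix t assume t: "t \<in> full_triples n - specified_triples n"
  obtain i j k where ijk: "t = (i, j, k)"
    by (cases t)
  have "{i, j} = {1, n} \<or> {j, k} = {1, n} \<or> {k, i} = {1, n}"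
    using t ijk by (auto simp: specified_triples_def)
  then show "t \<in> ?R"
    using t assms unfolding ijk full_triples_def by (auto simp: doubleton_eq_iff)
next
  fix t assume "t \<in> ?R"
  then show "t \<in> full_triples n - specified_triples n"
    using assms by (auto simp: full_triples_def specified_triples_def)
qed

lemma completion_eq_the: "{i, j} \<noteq> {1, n} \<Longrightarrow> completion n A x i j = the (A i j)"
  unfolding completion_def by (metis insert_commute)

text \<open>Only cycles through \<open>{1, n}\<close> depend on \<open>x\<close>, so equality says
  that none of them exceeds \<open>MT_partial n A\<close>. Rotation preserves a cycle product, so
  the six orderings for each \<open>j\<close> leave two bounds.\<close>

lemma MT_completion_eq_MT_partial_iff:
  assumes n: "n \<ge> 4" and A: "partial_reciprocal n A" "corner_unspecified n A" and x: "x > 0"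
  shows "MT n (completion n A x) = MT_partial n A \<longleftrightarrow>
    (\<forall>j\<in>{2..n - 1}. the (A 1 j) * the (A j n) / x \<le> MT_partial n A \<and>
                     x / (the (A 1 j) * the (A j n)) \<le> MT_partial n A)"
proof -
  let ?B = "completion n A x"
  have agree: "cycle_product ?B ` specified_triples n =
      cycle_product (\<lambda>i j. the (A i j)) ` specified_triples n"
  proof (intro image_cong refl)
    fix t assume t: "t \<in> specified_triples n"
    obtain i j k where ijk: "t = (i, j, k)"
      by (cases t)
    have "{i, j} \<noteq> {1, n}" "{j, k} \<noteq> {1, n}" "{k, i} \<noteq> {1, n}"
      using t unfolding ijk specified_triples_def by simp_all
    note this[THEN completion_eq_the]
    then show "cycle_product ?B t = cycle_product (\<lambda>i j. the (A i j)) t"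
      by (simp only: ijk cycle_product_def prod.case)
  qed
  \<comment> \<open>Since \<open>n\<close> is at least 4, the index 3 differs from \<open>n\<close>,
    so this cycle avoids the unspecified pair.\<close>
  have "(1, 2, 3) \<in> specified_triples n"
    using n by (auto simp: specified_triples_def full_triples_def doubleton_eq_iff)
  then have ne: "specified_triples n \<noteq> {}"
    by blast
  have cyc: "cycle_product ?B (1, j, n) = the (A 1 j) * the (A j n) / x"
    "cycle_product ?B (j, n, 1) = the (A 1 j) * the (A j n) / x"
    "cycle_product ?B (n, 1, j) = the (A 1 j) * the (A j n) / x"
    "cycle_product ?B (n, j, 1) = x / (the (A 1 j) * the (A j n))"
    "cycle_product ?B (j, 1, n) = x / (the (A 1 j) * the (A j n))"
    "cycle_product ?B (1, n, j) = x / (the (A 1 j) * the (A j n))"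
    if j: "j \<in> {2..n - 1}" for j
  proof -
    have jn: "2 \<le> j" "j < n"
      using j n by auto
    have "the (A j 1) = 1 / the (A 1 j)" "the (A n j) = 1 / the (A j n)"
      by (rule specified_entry(2)[OF A]; use jn in simp)+
    then show "cycle_product ?B (1, j, n) = the (A 1 j) * the (A j n) / x"
      "cycle_product ?B (j, n, 1) = the (A 1 j) * the (A j n) / x"
      "cycle_product ?B (n, 1, j) = the (A 1 j) * the (A j n) / x"
      "cycle_product ?B (n, j, 1) = x / (the (A 1 j) * the (A j n))"
      "cycle_product ?B (j, 1, n) = x / (the (A 1 j) * the (A j n))"
      "cycle_product ?B (1, n, j) = x / (the (A 1 j) * the (A j n))"
      using jn by (simp_all add: cycle_product_def completion_def)
  qed
  have "MT n ?B = MT_partial n A \<longleftrightarrow>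
      (\<forall>t\<in>full_triples n - specified_triples n. cycle_product ?B t \<le> MT_partial n A)"
    unfolding MT_eq MT_partial_eq agree[symmetric]
    by (rule Max_image_eq_Max_subset_iff[OF finite_full_triples specified_triples_subset ne])
  also have "\<dots> \<longleftrightarrow> (\<forall>j\<in>{2..n - 1}. the (A 1 j) * the (A j n) / x \<le> MT_partial n A \<and>
                     x / (the (A 1 j) * the (A j n)) \<le> MT_partial n A)"
    using n by (subst unspecified_triples) (auto simp: cyc simp del: One_nat_def)
  finally show ?thesis .
qed

text \<open>A cycle and its reversal have reciprocal products, so one of the two is at least 1. The
  bound also makes \<open>MT_partial n A\<close> positive, which justifies the later divisions by
  it.\<close>

lemma one_le_MT_partial:
  assumes n: "n \<ge> 4" and A: "partial_reciprocal n A" "corner_unspecified n A"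
  shows "MT_partial n A \<ge> 1"
proof -
  let ?a = "\<lambda>i j. the (A i j)"
  let ?t = "?a 1 2 * ?a 2 3 * ?a 3 1"
  have "(1, 2, 3) \<in> specified_triples n" "(1, 3, 2) \<in> specified_triples n"
    using n by (auto simp: specified_triples_def full_triples_def doubleton_eq_iff)
  then have le: "?t \<le> MT_partial n A" "?a 1 3 * ?a 3 2 * ?a 2 1 \<le> MT_partial n A"
    by (blast intro: cycle_product_le_MT_partial)+
  have pos: "?a 1 2 > 0" "?a 2 3 > 0" "?a 3 1 > 0"
    using n by (auto intro!: specified_entry(1)[OF A])
  have "?a 2 1 = 1 / ?a 1 2" "?a 3 2 = 1 / ?a 2 3" "?a 1 3 = 1 / ?a 3 1"
    using n by (auto intro!: specified_entry(2)[OF A])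
  then have inv: "?a 1 3 * ?a 3 2 * ?a 2 1 = 1 / ?t"
    by simp
  show ?thesis
  proof (cases "?t \<ge> 1")
    case False
    then have "1 / ?t \<ge> 1"
      using pos by (simp add: le_divide_eq)
    then show ?thesis
      using le(2) inv by linarith
  qed (use le(1) in linarith)
qed

text \<open>Applied to a maximizing \<open>j\<close> and a minimizing \<open>k\<close>, this makes
  the interval nonempty.\<close>

lemma path_product_le:
  assumes n: "n \<ge> 4" and A: "partial_reciprocal n A" "corner_unspecified n A"
    and j: "j \<in> {2..n - 1}" and k: "k \<in> {2..n - 1}"
  shows "the (A 1 j) * the (A j n) \<le> (MT_partial n A)\<^sup>2 * (the (A 1 k) * the (A k n))"
proof -
  let ?a = "\<lambda>i j. the (A i j)" and ?c = "MT_partial n A"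
  have c: "?c \<ge> 1"
    by (rule one_le_MT_partial[OF n A])
  have jk: "2 \<le> j" "j < n" "2 \<le> k" "k < n"
    using n j k by auto
  have pos: "?a 1 j > 0" "?a j n > 0" "?a 1 k > 0" "?a k n > 0" "?a j k > 0"
    by (rule specified_entry(1)[OF A]; use jk in simp)+
  show ?thesis
  proof (cases "j = k")
    case True
    have "1 \<le> ?c\<^sup>2"
      using c by simp
    then have "1 * (?a 1 k * ?a k n) \<le> ?c\<^sup>2 * (?a 1 k * ?a k n)"
      using pos by (intro mult_right_mono) auto
    then show ?thesis
      using True by simp
  next
    case False
    have "(1, j, k) \<in> specified_triples n" "(j, n, k) \<in> specified_triples n"
      using jk False by (auto simp: specified_triples_def full_triples_def doubleton_eq_iff)
    then have le: "?a 1 j * ?a j k * ?a k 1 \<le> ?c" "?a j n * ?a n k * ?a k j \<le> ?c"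
      by (blast intro: cycle_product_le_MT_partial)+
    have inv: "?a k 1 = 1 / ?a 1 k" "?a n k = 1 / ?a k n" "?a k j = 1 / ?a j k"
      by (rule specified_entry(2)[OF A]; use jk in simp)+
    have "(?a 1 j * ?a j k * ?a k 1) * (?a j n * ?a n k * ?a k j) \<le> ?c * ?c"
      using le c pos inv by (intro mult_mono) auto
    \<comment> \<open>The two cycles traverse the edge between \<open>j\<close> and \<open>k\<close>
      in opposite directions, so its entries cancel and only the two paths from \<open>1\<close> to
      \<open>n\<close> remain.\<close>
    moreover have "(?a 1 j * ?a j k * ?a k 1) * (?a j n * ?a n k * ?a k j) =
        (?a 1 j * ?a j n) / (?a 1 k * ?a k n)"
      using pos unfolding inv by (simp add: field_simps)
    ultimately show ?thesis
      using pos by (simp add: divide_le_eq power2_eq_square)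
  qed
qed

theorem theorem5p3:
  fixes n :: nat and A :: partial_matrix
  assumes "n \<ge> 4"
    and "partial_reciprocal n A"
    and "corner_unspecified n A"
  shows "(\<exists>x0::real. x0 > 0 \<and> MT n (completion n A x0) = MT_partial n A) \<and>
    {x0::real. x0 > 0 \<and> MT n (completion n A x0) = MT_partial n A} =
      {1 / MT_partial n A * M_S n A .. MT_partial n A * m_S n A}"
proof -
  let ?c = "MT_partial n A" and ?p = "\<lambda>j. the (A 1 j) * the (A j n)" and ?J = "{2..n - 1}"
  have c: "?c \<ge> 1"
    by (rule one_le_MT_partial[OF assms])
  have J: "finite (?p ` ?J)" "?p ` ?J \<noteq> {}"
    using assms(1) by auto
  have pos: "?p j > 0" if "j \<in> ?J" for j
    using that assms(1) by (intro mult_pos_pos specified_entry(1)[OF assms(2,3)]) auto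
  obtain j where j: "j \<in> ?J" "M_S n A = ?p j"
    using Max_in[OF J] unfolding M_S_def by blast
  obtain k where k: "k \<in> ?J" "m_S n A = ?p k"
    using Min_in[OF J] unfolding m_S_def by blast
  \<comment> \<open>An upper bound for the maximum, or a lower bound for the minimum, is a bound for
    every path product; this matches the conditions indexed by \<open>j\<close> above.\<close>
  have mem: "x \<in> {1 / ?c * M_S n A .. ?c * m_S n A} \<longleftrightarrow> (\<forall>j\<in>?J. ?p j \<le> ?c * x \<and> x / ?c \<le> ?p j)"
    for x
  proof -
    have "1 / ?c * M_S n A \<le> x \<longleftrightarrow> M_S n A \<le> ?c * x"
      using c by (simp add: divide_le_eq mult.commute)
    moreover have "M_S n A \<le> ?c * x \<longleftrightarrow> (\<forall>j\<in>?J. ?p j \<le> ?c * x)"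
      unfolding M_S_def using J by (subst Max_le_iff) auto
    moreover have "x \<le> ?c * m_S n A \<longleftrightarrow> x / ?c \<le> m_S n A"
      using c by (simp add: divide_le_eq mult.commute)
    moreover have "x / ?c \<le> m_S n A \<longleftrightarrow> (\<forall>j\<in>?J. x / ?c \<le> ?p j)"
      unfolding m_S_def using J by (subst Min_ge_iff) auto
    ultimately show ?thesis
      by auto
  qed
  have iff: "MT n (completion n A x) = ?c \<longleftrightarrow> x \<in> {1 / ?c * M_S n A .. ?c * m_S n A}"
    if x: "x > 0" for x
    unfolding MT_completion_eq_MT_partial_iff[OF assms x] mem
    using c x pos by (intro ball_cong refl) (simp add: divide_le_eq mult.commute)
  \<comment> \<open>With a positive lower endpoint the whole interval is positive, so restricting to
    \<open>x0 > 0\<close> removes none of it.\<close>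
  have lo: "1 / ?c * M_S n A > 0"
    unfolding j(2) using c by (intro mult_pos_pos[OF _ pos[OF j(1)]]) simp
  then have eq: "{x. x > 0 \<and> MT n (completion n A x) = ?c} =
      {1 / ?c * M_S n A .. ?c * m_S n A}"
    using iff by fastforce
  have "M_S n A \<le> ?c\<^sup>2 * m_S n A"
    unfolding j(2) k(2) by (rule path_product_le[OF assms j(1) k(1)])
  then have "1 / ?c * M_S n A \<le> ?c * m_S n A"
    using c by (simp add: divide_le_eq power2_eq_square mult_ac)
  \<comment> \<open>The lower endpoint serves as the witness for existence.\<close>
  then have "1 / ?c * M_S n A \<in> {x. x > 0 \<and> MT n (completion n A x) = ?c}"
    unfolding eq by simp
  then show ?thesis
    using eq by blast
qed

end
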